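(* Let $\Gamma$ be a set of relations over $\{0,1\}$ such that every operation in $\mathrm{Pol}(\Gamma)$ is essentially unary. Then $\langle\Gamma\rangle$ is $\exists!$-covered.
   Context: An operation $f\colon\{0,1\}^k\to\{0,1\}$ is essentially unary if there are a unary $g$ and an index $i$ with $f(x_1,\dots,x_k)=g(x_i)$ for all inputs. $\mathrm{Pol}(\Gamma)$ is the set of operations that, applied coordinatewise to tuples of any relation of $\Gamma$, yield tuples of that relation. A pp-definition of an $n$-ary relation $R$ over $\Gamma$ is a formula $R(x_1,\dots,x_n)\equiv\exists y_1,\dots,y_m\colon R_1(\mathbf{x}_1)\wedge\dots\wedge R_k(\mathbf{x}_k)$ with $R_j\in\Gamma\cup\{\mathrm{Eq}\}$ (equality relation) and $\mathbf{x}_j$ tuples of variables among $x_1,\dots,x_n,y_1,\dots,y_m$; $\langle\Gamma\rangle$ is the set of pp-definable relations (a co-clone); $\Delta$ is a base of a co-clone $C$ if $\langle\Delta\rangle=C$. A upp-definition is a pp-definition where each $y_j$ is uniquely determined by $x_1,\dots,x_n$ (a function of their values in every satisfying assignment of the conjunction); $\langle\Delta\rangle_{\exists!}$ is the set of upp-definable relations. $C$ is $\exists!$-covered if $\langle\Delta\rangle_{\exists!}=C$ for every base $\Delta$ of $C$. *)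

theory Defs
  imports Main
begin

text \<open>Tuples over the domain are Boolean lists. The arity of a relation or operation is carried
  explicitly; in particular, empty relations of different arities are different relations.
  An operation is only meaningful on lists whose length is its arity.\<close>

type_synonym brel = "nat \<times> bool list set"
type_synonym bop = "nat \<times> (bool list \<Rightarrow> bool)"

definition relations :: "brel set" where
  "relations = {(n, R). \<forall>t\<in>R. length t = n}"

definition Eq_rel :: brel where
  "Eq_rel = (2, {[a, a] | a. True})"

definition essentially_unary :: "bop \<Rightarrow> bool" where
  "essentially_unary = (\<lambda>(k, f). \<exists>g :: bool \<Rightarrow> bool. \<exists>i<k. \<forall>xs. length xs = k \<longrightarrow> f xs = g (xs ! i))"

definition preserves :: "bop \<Rightarrow> brel \<Rightarrow> bool" where
  "preserves = (\<lambda>(k, f) (n, R). \<forall>ts. length ts = k \<and> set ts \<subseteq> R \<longrightarrow>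
     map (\<lambda>j. f (map (\<lambda>t. t ! j) ts)) [0..<n] \<in> R)"

text \<open>Operations have positive arity: a nullary operation has no index to depend on, so it could
  never be essentially unary.\<close>

definition Pol :: "brel set \<Rightarrow> bop set" where
  "Pol \<Gamma> = {(k, f). 1 \<le> k \<and> (\<forall>r\<in>\<Gamma>. preserves (k, f) r)}"

text \<open>An atom is a relation applied to a tuple of variables, and a conjunction is a list of atoms.
  In a formula with \<open>n\<close> free and \<open>m\<close> quantified variables, the free variables
  are \<open>0, \<dots>, n - 1\<close> and the quantified ones \<open>n, \<dots>, n + m - 1\<close>.\<close>

type_synonym atom = "brel \<times> nat list"

definition wf_conj :: "brel set \<Rightarrow> nat \<Rightarrow> atom list \<Rightarrow> bool" where
  "wf_conj \<Gamma> v \<phi> \<longleftrightarrow>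
     (\<forall>(r, vs)\<in>set \<phi>. r \<in> \<Gamma> \<union> {Eq_rel} \<and> length vs = fst r \<and> (\<forall>i\<in>set vs. i < v))"

definition sat :: "atom list \<Rightarrow> bool list \<Rightarrow> bool" where
  "sat \<phi> zs \<longleftrightarrow> (\<forall>(r, vs)\<in>set \<phi>. map (\<lambda>i. zs ! i) vs \<in> snd r)"

definition pp_definition :: "brel set \<Rightarrow> nat \<Rightarrow> atom list \<Rightarrow> brel \<Rightarrow> bool" where
  "pp_definition \<Gamma> m \<phi> = (\<lambda>(n, R). wf_conj \<Gamma> (n + m) \<phi> \<and>
     R = {xs. length xs = n \<and> (\<exists>ys. length ys = m \<and> sat \<phi> (xs @ ys))})"

definition upp_definition :: "brel set \<Rightarrow> nat \<Rightarrow> atom list \<Rightarrow> brel \<Rightarrow> bool" where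
  "upp_definition \<Gamma> m \<phi> r \<longleftrightarrow> pp_definition \<Gamma> m \<phi> r \<and>
     (\<forall>j<m. \<exists>h :: bool list \<Rightarrow> bool. \<forall>xs ys.
        length xs = fst r \<and> length ys = m \<and> sat \<phi> (xs @ ys) \<longrightarrow> ys ! j = h xs)"

definition pp_closure :: "brel set \<Rightarrow> brel set" where
  "pp_closure \<Gamma> = {r. \<exists>m \<phi>. pp_definition \<Gamma> m \<phi> r}"

definition upp_closure :: "brel set \<Rightarrow> brel set" where
  "upp_closure \<Gamma> = {r. \<exists>m \<phi>. upp_definition \<Gamma> m \<phi> r}"

definition is_base :: "brel set \<Rightarrow> brel set \<Rightarrow> bool" where
  "is_base \<Delta> C \<longleftrightarrow> \<Delta> \<subseteq> relations \<and> pp_closure \<Delta> = C"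

definition uniquely_covered :: "brel set \<Rightarrow> bool" where
  "uniquely_covered C \<longleftrightarrow> (\<forall>\<Delta>. is_base \<Delta> C \<longrightarrow> upp_closure \<Delta> = C)"

end

theory Submission
  imports Defs
begin

text \<open>Let \<open>\<Delta>\<close> be a base; its polymorphisms are again essentially unary. List a subset
  \<open>T\<close> of a pp-definable relation \<open>R\<close> as the rows of a matrix with \<open>k\<close> rows, and introduce
  one quantified variable for every Boolean column of height \<open>k\<close>. The conjunction of all atoms
  over \<open>\<Delta>\<close> satisfied by the \<open>k\<close> rows has exactly the \<open>k\<close>-ary polymorphisms of \<open>\<Delta>\<close> as
  satisfying assignments, so it defines the closure of \<open>T\<close> under polymorphisms. Choosing \<open>T\<close> to
  contain one tuple from each pair of complementary tuples if negation is a polymorphism, and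
  no constant tuple whose constant operation is a polymorphism, this closure is \<open>R\<close>, and a tuple
  \<open>x \<in> R\<close> determines the (essentially unary) polymorphism producing it from \<open>T\<close>, hence all
  quantified variables. If \<open>T\<close> is empty, then \<open>R\<close> consists of constant tuples and is defined
  without quantifiers.\<close>

section \<open>Unary polymorphisms\<close>

text \<open>A unary operation is kept as a plain function on \<open>bool\<close>, so that it can be
  composed and split into cases directly. For sets of well-formed relations this is membership of
  the corresponding operation of arity 1 in \<open>Pol \<Delta>\<close>.\<close>

definition unary_pol :: "brel set \<Rightarrow> (bool \<Rightarrow> bool) \<Rightarrow> bool" where
  "unary_pol \<Delta> g \<longleftrightarrow> (\<forall>(n, R)\<in>\<Delta>. \<forall>t\<in>R. map g t \<in> R)"

lemma sat_iff: "sat \<phi> zs \<longleftrightarrow> (\<forall>a\<in>set \<phi>. sat [a] zs)"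
  by (auto simp: sat_def)

lemma wf_conj_iff: "wf_conj \<Delta> v \<phi> \<longleftrightarrow> (\<forall>a\<in>set \<phi>. wf_conj \<Delta> v [a])"
  by (auto simp: wf_conj_def)

lemma relations_length: "\<Delta> \<subseteq> relations \<Longrightarrow> (n, R) \<in> \<Delta> \<Longrightarrow> t \<in> R \<Longrightarrow> length t = n"
  by (auto simp: relations_def)

lemma unary_pol_comp: "unary_pol \<Delta> g \<Longrightarrow> unary_pol \<Delta> h \<Longrightarrow> unary_pol \<Delta> (\<lambda>x. g (h x))"
proof -
  have "map (\<lambda>x. g (h x)) t = map g (map h t)" for t by simp
  then show "unary_pol \<Delta> g \<Longrightarrow> unary_pol \<Delta> h \<Longrightarrow> unary_pol \<Delta> (\<lambda>x. g (h x))"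
    unfolding unary_pol_def by (fastforce simp del: map_map)
qed

text \<open>Atoms may use equality besides the relations of \<open>\<Delta>\<close>. Tuples of the
  equality relation have two identical columns, on which any \<open>f\<close> takes the same
  value.\<close>

lemma preserves_Eq_rel: "preserves (k, f) Eq_rel"
proof -
  have "map (\<lambda>j. f (map (\<lambda>t. t ! j) ts)) [0..<2] \<in> snd Eq_rel" if "set ts \<subseteq> snd Eq_rel" for ts
  proof -
    have "map (\<lambda>t. t ! 0) ts = map (\<lambda>t. t ! 1) ts"
      using that by (auto simp: Eq_rel_def)
    then have "f (map (\<lambda>t. t ! 0) ts) = f (map (\<lambda>t. t ! 1) ts)" by (rule arg_cong)
    then show ?thesis by (simp add: Eq_rel_def numeral_2_eq_2)
  qed
  then show ?thesis by (auto simp: preserves_def Eq_rel_def)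
qed

lemma Pol_unary:
  assumes "\<Delta> \<subseteq> relations" "unary_pol \<Delta> g" "i < k"
  shows "(k, \<lambda>xs. g (xs ! i)) \<in> Pol \<Delta>"
proof -
  have "map (\<lambda>j. g (map (\<lambda>t. t ! j) ts ! i)) [0..<n] \<in> R"
    if r: "(n, R) \<in> \<Delta>" and ts: "length ts = k" "set ts \<subseteq> R" for n R ts
  proof -
    have t: "ts ! i \<in> R" using ts assms(3) by (auto simp: subset_iff)
    have "map (\<lambda>j. g (map (\<lambda>t. t ! j) ts ! i)) [0..<n] = map g (ts ! i)"
      using relations_length[OF assms(1) r t] ts assms(3) by (intro nth_equalityI) auto
    then show ?thesis using assms(2) r t by (auto simp: unary_pol_def)
  qed
  then show ?thesis using assms(3) by (auto simp: Pol_def preserves_def)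
qed

text \<open>The unary function behind a polymorphism is itself a polymorphism: applying
  \<open>f\<close> to \<open>k\<close> copies of one tuple \<open>t\<close> gives
  \<open>map g t\<close>.\<close>

lemma essentially_unary_Pol:
  assumes "\<Delta> \<subseteq> relations" "(k, f) \<in> Pol \<Delta>" "essentially_unary (k, f)"
  obtains g i where "unary_pol \<Delta> g" "i < k" "\<And>xs. length xs = k \<Longrightarrow> f xs = g (xs ! i)"
proof -
  obtain g i where i: "i < k" and g: "\<And>xs. length xs = k \<Longrightarrow> f xs = g (xs ! i)"
    using assms(3) by (auto simp: essentially_unary_def)
  have "map g t \<in> R" if r: "(n, R) \<in> \<Delta>" and t: "t \<in> R" for n R t
  proof -
    have "preserves (k, f) (n, R)" using assms(2) r by (auto simp: Pol_def)
    then have "map (\<lambda>j. f (map (\<lambda>t. t ! j) (replicate k t))) [0..<n] \<in> R"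
      unfolding preserves_def prod.case using t by (elim allE[of _ "replicate k t"]) auto
    moreover have "map (\<lambda>j. f (map (\<lambda>t. t ! j) (replicate k t))) [0..<n] = map g t"
      using relations_length[OF assms(1) r t] i by (intro nth_equalityI) (auto simp: g)
    ultimately show ?thesis by simp
  qed
  then have "unary_pol \<Delta> g" by (auto simp: unary_pol_def)
  then show ?thesis using that i g by blast
qed

section \<open>Polymorphisms preserve pp-definable relations\<close>

text \<open>Reading one atom in the \<open>k\<close> assignments gives \<open>k\<close> tuples of
  its relation, and selecting the variables of an atom commutes with applying \<open>f\<close>
  coordinatewise.\<close>

lemma sat_Pol:
  assumes f: "(k, f) \<in> Pol \<Delta>" and wf: "wf_conj \<Delta> v \<phi>"
    and zss: "length zss = k" "\<And>z. z \<in> set zss \<Longrightarrow> sat \<phi> z"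
  shows "sat \<phi> (map (\<lambda>j. f (map (\<lambda>z. z ! j) zss)) [0..<v])"
proof -
  have "map (\<lambda>i. map (\<lambda>j. f (map (\<lambda>z. z ! j) zss)) [0..<v] ! i) vs \<in> R"
    if a: "((n, R), vs) \<in> set \<phi>" for n R vs
  proof -
    let ?ts = "map (\<lambda>z. map (\<lambda>i. z ! i) vs) zss"
    have w: "(n, R) \<in> \<Delta> \<union> {Eq_rel}" "length vs = n" "\<And>i. i \<in> set vs \<Longrightarrow> i < v"
      using wf a unfolding wf_conj_def by force+
    have "preserves (k, f) (n, R)"
      using w(1) f preserves_Eq_rel[of k f] by (auto simp: Pol_def)
    moreover have "set ?ts \<subseteq> R" using zss(2) a by (fastforce simp: sat_def)
    ultimately have "map (\<lambda>j. f (map (\<lambda>t. t ! j) ?ts)) [0..<n] \<in> R"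
      using zss(1) unfolding preserves_def prod.case by (elim allE[of _ ?ts]) simp
    moreover have "map (\<lambda>j. f (map (\<lambda>t. t ! j) ?ts)) [0..<n]
        = map (\<lambda>i. map (\<lambda>j. f (map (\<lambda>z. z ! j) zss)) [0..<v] ! i) vs"
      using w by (intro nth_equalityI) (auto simp: comp_def)
    ultimately show ?thesis by simp
  qed
  then show ?thesis unfolding sat_def by auto
qed

text \<open>Extend each tuple by witnesses for the quantified variables and apply \<open>f\<close>
  to the extended assignments. The first \<open>n\<close> coordinates are the image of the tuples,
  and the remaining ones are witnesses for it.\<close>

lemma preserves_pp_closure:
  assumes f: "(k, f) \<in> Pol \<Delta>" and r: "r \<in> pp_closure \<Delta>"
  shows "preserves (k, f) r"
proof -
  obtain n R m \<phi> where rn: "r = (n, R)" and wf: "wf_conj \<Delta> (n + m) \<phi>"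
    and R: "R = {xs. length xs = n \<and> (\<exists>ys. length ys = m \<and> sat \<phi> (xs @ ys))}"
    using r by (cases r) (auto simp: pp_closure_def pp_definition_def)
  have "map (\<lambda>j. f (map (\<lambda>t. t ! j) ts)) [0..<n] \<in> R"
    if ts: "length ts = k" "set ts \<subseteq> R" for ts
  proof -
    have "\<forall>t\<in>set ts. \<exists>ys. length t = n \<and> length ys = m \<and> sat \<phi> (t @ ys)"
      using ts(2) R by auto
    then obtain y where y: "\<And>t. t \<in> set ts \<Longrightarrow> length t = n \<and> length (y t) = m \<and> sat \<phi> (t @ y t)"
      by metis
    define z where "z = map (\<lambda>j. f (map (\<lambda>z. z ! j) (map (\<lambda>t. t @ y t) ts))) [0..<n + m]"
    have "sat \<phi> z" unfolding z_def
      by (rule sat_Pol[OF f wf]) (use ts y in auto)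
    moreover have "map (\<lambda>j. f (map (\<lambda>t. t ! j) ts)) [0..<n] = take n z"
    proof (rule nth_equalityI)
      fix j assume "j < length (map (\<lambda>j. f (map (\<lambda>t. t ! j) ts)) [0..<n])"
      then have j: "j < n" by simp
      have "map (\<lambda>t. t ! j) ts = map (\<lambda>t. (t @ y t) ! j) ts"
        using y j by (auto simp: nth_append)
      then have "f (map (\<lambda>t. t ! j) ts) = f (map (\<lambda>t. (t @ y t) ! j) ts)" by (rule arg_cong)
      then show "map (\<lambda>j. f (map (\<lambda>t. t ! j) ts)) [0..<n] ! j = take n z ! j"
        using j by (simp add: z_def comp_def)
    qed (simp add: z_def)
    moreover have "length z = n + m" by (simp add: z_def)
    ultimately have "length (take n z) = n \<and> length (drop n z) = m \<and> sat \<phi> (take n z @ drop n z)"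
      by simp
    then show ?thesis
      unfolding \<open>_ = take n z\<close> R by blast
  qed
  then show ?thesis by (auto simp: rn preserves_def)
qed

lemma pp_closure_length: "(n, R) \<in> pp_closure \<Delta> \<Longrightarrow> t \<in> R \<Longrightarrow> length t = n"
  by (auto simp: pp_closure_def pp_definition_def)

lemma pp_closure_unary_pol:
  assumes "\<Delta> \<subseteq> relations" "(n, R) \<in> pp_closure \<Delta>" "unary_pol \<Delta> g" "t \<in> R"
  shows "map g t \<in> R"
proof -
  have "preserves (1, \<lambda>xs. g (xs ! 0)) (n, R)"
    using preserves_pp_closure[OF Pol_unary[OF assms(1,3)] assms(2)] by simp
  then have "map (\<lambda>j. g (map (\<lambda>t. t ! j) [t] ! 0)) [0..<n] \<in> R"
    unfolding preserves_def using assms(4)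
    by (auto dest!: spec[of _ "[t]"])
  moreover have "map (\<lambda>j. g (map (\<lambda>t. t ! j) [t] ! 0)) [0..<n] = map g t"
    using pp_closure_length[OF assms(2,4)] by (intro nth_equalityI) auto
  ultimately show ?thesis by simp
qed

lemma subset_pp_closure:
  assumes "\<Gamma> \<subseteq> relations"
  shows "\<Gamma> \<subseteq> pp_closure \<Gamma>"
proof
  fix r assume r: "r \<in> \<Gamma>"
  obtain n R where rn: "r = (n, R)" by (cases r)
  have "pp_definition \<Gamma> 0 [(r, [0..<n])] r"
    using r relations_length[OF assms, of n R]
    by (auto simp: rn pp_definition_def wf_conj_def sat_def) (metis map_nth)+
  then show "r \<in> pp_closure \<Gamma>" by (auto simp: pp_closure_def)
qed

section \<open>Conjunctions whose satisfying assignments are polymorphisms\<close>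

text \<open>Although \<open>\<Delta>\<close> may be infinite, finitely many atoms suffice, one for each of the
  finitely many assignments to be excluded.\<close>

lemma strongest_conj:
  obtains \<phi> where "wf_conj \<Delta> v \<phi>" "\<And>z. z \<in> S \<Longrightarrow> sat \<phi> z"
    "\<And>zs a. length zs = v \<Longrightarrow> sat \<phi> zs \<Longrightarrow> wf_conj \<Delta> v [a] \<Longrightarrow> (\<And>z. z \<in> S \<Longrightarrow> sat [a] z)
      \<Longrightarrow> sat [a] zs"
proof -
  define A where "A = {a. wf_conj \<Delta> v [a] \<and> (\<forall>z\<in>S. sat [a] z)}"
  define B where "B = {zs. length zs = v \<and> (\<exists>a\<in>A. \<not> sat [a] zs)}"
  have "B \<subseteq> {zs. set zs \<subseteq> UNIV \<and> length zs = v}" by (auto simp: B_def)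
  then have "finite B" using finite_lists_length_eq[of UNIV v] finite_subset finite by blast
  then obtain bs where bs: "set bs = B" using finite_list by blast
  have "\<forall>zs\<in>B. \<exists>a. a \<in> A \<and> \<not> sat [a] zs" by (auto simp: B_def)
  then obtain c where c: "\<And>zs. zs \<in> B \<Longrightarrow> c zs \<in> A \<and> \<not> sat [c zs] zs" by metis
  show ?thesis
  proof (rule that[of "map c bs"])
    show "wf_conj \<Delta> v (map c bs)"
      using c by (subst wf_conj_iff) (auto simp: bs A_def)
    show "sat (map c bs) z" if "z \<in> S" for z
      using c that by (subst sat_iff) (auto simp: bs A_def)
    show "sat [a] zs" if "length zs = v" "sat (map c bs) zs" "wf_conj \<Delta> v [a]"
      "\<And>z. z \<in> S \<Longrightarrow> sat [a] z" for zs a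
    proof (rule ccontr)
      assume "\<not> sat [a] zs"
      moreover have "a \<in> A" using that by (simp add: A_def)
      ultimately have "zs \<in> B" using that(1) by (auto simp only: B_def)
      then show False using c that(2) by (subst (asm) sat_iff) (auto simp: bs)
    qed
  qed
qed

lemma sat_Eq_rel: "sat [(Eq_rel, [i, j])] zs \<longleftrightarrow> zs ! i = zs ! j"
  by (auto simp: sat_def Eq_rel_def)

lemma wf_conj_Eq_rel: "wf_conj \<Delta> v [(Eq_rel, [i, j])] \<longleftrightarrow> i < v \<and> j < v"
  by (auto simp: wf_conj_def Eq_rel_def)

text \<open>With one variable per column, an assignment is the value table of a \<open>k\<close>-ary
  operation, and the rows are the tables of the projections. A polymorphism applied to the rows
  gives its own table. Conversely, each instance of preservation is an atom that all rows satisfy,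
  so \<open>\<phi>\<close> enforces it. Columns may repeat in \<open>cols\<close>, because some of
  them will serve both as free and as quantified variables.\<close>

lemma conj_defining_Pol:
  assumes rel: "\<Delta> \<subseteq> relations" and k: "1 \<le> k"
    and cols: "set cols = {u. length u = k}"
  obtains \<phi> where "wf_conj \<Delta> (length cols) \<phi>"
    "\<And>zs. length zs = length cols \<Longrightarrow> sat \<phi> zs \<longleftrightarrow> (\<exists>f. (k, f) \<in> Pol \<Delta> \<and> zs = map f cols)"
proof -
  define row where "row l = map (\<lambda>u. u ! l) cols" for l
  let ?v = "length cols"
  obtain \<phi> where wf: "wf_conj \<Delta> ?v \<phi>" and rows: "\<And>z. z \<in> row ` {..<k} \<Longrightarrow> sat \<phi> z"
    and strong: "\<And>zs a. length zs = ?v \<Longrightarrow> sat \<phi> zs \<Longrightarrow> wf_conj \<Delta> ?v [a]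
      \<Longrightarrow> (\<And>z. z \<in> row ` {..<k} \<Longrightarrow> sat [a] z) \<Longrightarrow> sat [a] zs"
    using strongest_conj[of \<Delta> ?v "row ` {..<k}"] by blast
  have len: "length (cols ! j) = k" if "j < ?v" for j
    using that cols nth_mem by blast
  have "sat \<phi> zs" if f: "(k, f) \<in> Pol \<Delta>" and zs: "zs = map f cols" for zs f
  proof -
    have "sat \<phi> (map (\<lambda>j. f (map (\<lambda>z. z ! j) (map row [0..<k]))) [0..<?v])"
      by (rule sat_Pol[OF f wf]) (auto intro: rows)
    moreover have "map (\<lambda>z. z ! j) (map row [0..<k]) = cols ! j" if "j < ?v" for j
      using that len[OF that] by (intro nth_equalityI) (auto simp: row_def)
    then have "map (\<lambda>j. f (map (\<lambda>z. z ! j) (map row [0..<k]))) [0..<?v] = zs"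
      unfolding zs by (intro nth_equalityI) auto
    ultimately show ?thesis by simp
  qed
  moreover have "\<exists>f. (k, f) \<in> Pol \<Delta> \<and> zs = map f cols"
    if len_zs: "length zs = ?v" and sat: "sat \<phi> zs" for zs
  proof -
    have "\<exists>j<?v. cols ! j = u" if "length u = k" for u
    proof -
      have "u \<in> set cols" unfolding cols using that by blast
      then show ?thesis by (simp add: in_set_conv_nth)
    qed
    then obtain p where p: "\<And>u. length u = k \<Longrightarrow> p u < ?v \<and> cols ! p u = u" by metis
    \<comment> \<open>Equality atoms between repeated columns make the value independent of the
      occurrence that \<open>p\<close> picks, so that \<open>zs\<close> is the full table of
      \<open>\<lambda>u. zs ! p u\<close>.\<close>
    have eq: "zs ! i = zs ! j" if "i < ?v" "j < ?v" "cols ! i = cols ! j" for i j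
    proof -
      have "sat [(Eq_rel, [i, j])] zs"
        by (rule strong[OF len_zs sat]) (use that in \<open>auto simp: wf_conj_Eq_rel sat_Eq_rel row_def\<close>)
      then show ?thesis by (simp add: sat_Eq_rel)
    qed
    have "preserves (k, \<lambda>u. zs ! p u) r" if r: "r \<in> \<Delta>" for r
    proof -
      obtain n R where rn: "r = (n, R)" by (cases r)
      have "map (\<lambda>j. zs ! p (map (\<lambda>t. t ! j) ts)) [0..<n] \<in> R"
        if ts: "length ts = k" "set ts \<subseteq> R" for ts
      proof -
        \<comment> \<open>Variable \<open>j\<close> of this atom is the column of
          \<open>j\<close>-th entries of \<open>ts\<close>, so row \<open>l\<close> reads off
          exactly the tuple \<open>ts ! l\<close>.\<close>
        let ?vs = "map (\<lambda>j. p (map (\<lambda>t. t ! j) ts)) [0..<n]"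
        have "sat [(r, ?vs)] zs"
        proof (rule strong[OF len_zs sat])
          show "wf_conj \<Delta> ?v [(r, ?vs)]"
            using r p ts(1) by (auto simp: wf_conj_def rn)
          fix z assume "z \<in> row ` {..<k}"
          then obtain l where l: "l < k" "z = row l" by auto
          have tl: "ts ! l \<in> R" using ts l by auto
          have "map (\<lambda>i. z ! i) ?vs = ts ! l"
            using relations_length[OF rel r[unfolded rn] tl] l ts(1) p
            by (intro nth_equalityI) (auto simp: row_def)
          then show "sat [(r, ?vs)] z" using tl by (simp add: sat_def rn del: map_map)
        qed
        then show ?thesis by (simp add: sat_def rn comp_def)
      qed
      then show ?thesis by (auto simp: preserves_def rn)
    qed
    then have "(k, \<lambda>u. zs ! p u) \<in> Pol \<Delta>" using k by (auto simp: Pol_def)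
    moreover have "zs = map (\<lambda>u. zs ! p u) cols"
    proof (rule nth_equalityI)
      fix i assume "i < length zs"
      then have "i < ?v" using len_zs by simp
      then show "zs ! i = map (\<lambda>u. zs ! p u) cols ! i"
        using eq[of i "p (cols ! i)"] p[OF len] by simp
    qed (simp add: len_zs)
    ultimately show ?thesis by (intro exI[of _ "\<lambda>u. zs ! p u"]) blast
  qed
  ultimately show ?thesis using that wf by blast
qed

section \<open>Two constructions of upp-definitions\<close>

text \<open>This serves the case where no rows remain to form columns from. The strongest
  conjunction valid on \<open>R\<close> has equality atoms that force a constant tuple, and atoms
  repeating one variable that force its value to be a constant polymorphism.\<close>

lemma constant_relation_upp:
  assumes rel: "\<Delta> \<subseteq> relations" and n: "0 < n"
    and R: "R = {replicate n c | c. unary_pol \<Delta> (\<lambda>_. c)}" and ne: "R \<noteq> {}"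
  shows "(n, R) \<in> upp_closure \<Delta>"
proof -
  obtain \<phi> where wf: "wf_conj \<Delta> n \<phi>" and rows: "\<And>z. z \<in> R \<Longrightarrow> sat \<phi> z"
    and strong: "\<And>zs a. length zs = n \<Longrightarrow> sat \<phi> zs \<Longrightarrow> wf_conj \<Delta> n [a]
      \<Longrightarrow> (\<And>z. z \<in> R \<Longrightarrow> sat [a] z) \<Longrightarrow> sat [a] zs"
    using strongest_conj[of \<Delta> n R] by blast
  have "zs \<in> R" if zs: "length zs = n" "sat \<phi> zs" for zs
  proof -
    have "zs ! i = zs ! 0" if "i < n" for i
    proof -
      have "sat [(Eq_rel, [i, 0])] zs"
        by (rule strong[OF zs]) (use that n R in \<open>auto simp: wf_conj_Eq_rel sat_Eq_rel\<close>)
      then show ?thesis by (simp add: sat_Eq_rel)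
    qed
    then have "\<forall>x\<in>set zs. x = zs ! 0" using zs(1) by (metis in_set_conv_nth)
    then have zs_eq: "zs = replicate n (zs ! 0)"
      using replicate_eqI[of zs n "zs ! 0"] zs(1) by blast
    have "map (\<lambda>_. zs ! 0) t \<in> Q" if r: "(a, Q) \<in> \<Delta>" and t: "t \<in> Q" for a Q t
    proof -
      have lt: "length t = a" using relations_length[OF rel r t] .
      \<comment> \<open>Since \<open>Q\<close> contains \<open>t\<close>, it contains the constant
        tuple for every constant polymorphism, so all members of \<open>R\<close> satisfy this
        atom.\<close>
      have "sat [((a, Q), replicate a 0)] zs"
      proof (rule strong[OF zs])
        show "wf_conj \<Delta> n [((a, Q), replicate a 0)]"
          using r n by (auto simp: wf_conj_def)
        fix z assume "z \<in> R"
        then obtain c where c: "z = replicate n c" "unary_pol \<Delta> (\<lambda>_. c)" using R by auto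
        have "map (\<lambda>_. c) t \<in> Q" using c(2) r t by (auto simp: unary_pol_def)
        then show "sat [((a, Q), replicate a 0)] z"
          using lt n by (simp add: sat_def c(1) map_replicate_const)
      qed
      then show ?thesis using lt by (simp add: sat_def map_replicate_const)
    qed
    then have "unary_pol \<Delta> (\<lambda>_. zs ! 0)" by (auto simp: unary_pol_def)
    then show ?thesis using zs_eq R by blast
  qed
  then have "R = {xs. length xs = n \<and> (\<exists>ys. length ys = 0 \<and> sat \<phi> (xs @ ys))}"
    using rows R by auto
  then have "upp_definition \<Delta> 0 \<phi> (n, R)"
    using wf by (simp add: upp_definition_def pp_definition_def)
  then show ?thesis by (auto simp: upp_closure_def)
qed

text \<open>The free variables are the columns of \<open>ts\<close>, and the quantified ones list
  all columns of height \<open>k\<close>, so a satisfying assignment consists of the image of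
  \<open>ts\<close> under some \<open>f\<close> followed by the whole table of \<open>f\<close>. By
  \<open>inj\<close> the image determines the table, which is the uniqueness of the
  witnesses.\<close>

lemma generated_relation_upp:
  assumes rel: "\<Delta> \<subseteq> relations" and k: "1 \<le> length ts"
    and R: "R = {map (\<lambda>j. f (map (\<lambda>t. t ! j) ts)) [0..<n] | f. (length ts, f) \<in> Pol \<Delta>}"
    and inj: "\<And>f g u. (length ts, f) \<in> Pol \<Delta> \<Longrightarrow> (length ts, g) \<in> Pol \<Delta> \<Longrightarrow>
      (\<And>j. j < n \<Longrightarrow> f (map (\<lambda>t. t ! j) ts) = g (map (\<lambda>t. t ! j) ts)) \<Longrightarrow>
      length u = length ts \<Longrightarrow> f u = g u"
  shows "(n, R) \<in> upp_closure \<Delta>"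
proof -
  let ?k = "length ts"
  let ?cs = "map (\<lambda>j. map (\<lambda>t. t ! j) ts) [0..<n]"
  define us where "us = List.n_lists ?k [False, True]"
  define m where "m = length us"
  have us: "set us = {u. length u = ?k}"
    by (auto simp: us_def set_n_lists)
  have "set (?cs @ us) = {u. length u = ?k}" 
    unfolding set_append us by (rule Un_absorb1) auto
  moreover have "length (?cs @ us) = n + m" by (simp add: m_def)
  ultimately obtain \<phi> where wf: "wf_conj \<Delta> (n + m) \<phi>" and sat: "\<And>zs. length zs = n + m \<Longrightarrow>
      sat \<phi> zs \<longleftrightarrow> (\<exists>f. (?k, f) \<in> Pol \<Delta> \<and> zs = map f (?cs @ us))"
    using conj_defining_Pol[OF rel k, of "?cs @ us" thesis] by simp
  have sat_iff: "sat \<phi> (xs @ ys) \<longleftrightarrow> (\<exists>f. (?k, f) \<in> Pol \<Delta> \<and> xs = map f ?cs \<and> ys = map f us)"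
    if "length xs = n" "length ys = m" for xs ys
    using sat[of "xs @ ys"] that by (simp add: m_def)
  have cs: "map f ?cs = map (\<lambda>j. f (map (\<lambda>t. t ! j) ts)) [0..<n]" for f :: "bool list \<Rightarrow> bool"
    by simp
  have "R = {xs. length xs = n \<and> (\<exists>ys. length ys = m \<and> sat \<phi> (xs @ ys))}"
  proof (intro set_eqI iffI)
    fix xs assume "xs \<in> R"
    then obtain f where f: "(?k, f) \<in> Pol \<Delta>" "xs = map f ?cs" unfolding R cs by blast
    then have "length xs = n" "length (map f us) = m" by (simp_all add: m_def)
    then show "xs \<in> {xs. length xs = n \<and> (\<exists>ys. length ys = m \<and> sat \<phi> (xs @ ys))}"
      using sat_iff f by blast
  next
    fix xs assume "xs \<in> {xs. length xs = n \<and> (\<exists>ys. length ys = m \<and> sat \<phi> (xs @ ys))}"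
    then obtain f where "(?k, f) \<in> Pol \<Delta>" "xs = map f ?cs" using sat_iff by blast
    then show "xs \<in> R" unfolding R cs by blast
  qed
  then have "pp_definition \<Delta> m \<phi> (n, R)" using wf by (simp add: pp_definition_def)
  moreover have "\<exists>h. \<forall>xs ys. length xs = n \<and> length ys = m \<and> sat \<phi> (xs @ ys) \<longrightarrow> ys ! j = h xs"
    if j: "j < m" for j
  proof -
    have uniq: "ys ! j = ys' ! j" if a: "length xs = n" "length ys = m" "sat \<phi> (xs @ ys)"
      "length ys' = m" "sat \<phi> (xs @ ys')" for xs ys ys'
    proof -
      obtain f where f: "(?k, f) \<in> Pol \<Delta>" "xs = map f ?cs" "ys = map f us"
        using sat_iff[OF a(1,2)] a(3) by blast
      obtain g where g: "(?k, g) \<in> Pol \<Delta>" "xs = map g ?cs" "ys' = map g us"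
        using sat_iff[OF a(1,4)] a(5) by blast
      have "length (us ! j) = ?k" using j us nth_mem[of j us] by (auto simp: m_def)
      moreover have "f (map (\<lambda>t. t ! j) ts) = g (map (\<lambda>t. t ! j) ts)" if "j < n" for j
      proof -
        have "map f ?cs ! j = map g ?cs ! j" by (simp only: f(2)[symmetric] g(2)[symmetric])
        then show ?thesis using that by simp
      qed
      ultimately have "f (us ! j) = g (us ! j)" using inj[OF f(1) g(1)] by blast
      then show ?thesis unfolding f(3) g(3) using j by (simp add: m_def)
    qed
    \<comment> \<open>Any choice of satisfying \<open>ys\<close> gives the required function, since
      \<open>uniq\<close> makes the choice immaterial.\<close>
    show ?thesis
      by (rule exI[of _ "\<lambda>xs. (SOME ys. length ys = m \<and> sat \<phi> (xs @ ys)) ! j"])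
        (metis (mono_tags, lifting) someI_ex uniq)
  qed
  ultimately have "upp_definition \<Delta> m \<phi> (n, R)" by (auto simp: upp_definition_def)
  then show ?thesis by (auto simp: upp_closure_def)
qed

section \<open>Relations over a base with essentially unary polymorphisms\<close>

lemma bool_fun_cases:
  fixes g :: "bool \<Rightarrow> bool"
  obtains c where "g = (\<lambda>_. c)" | "g = (\<lambda>x. x)" | "g = Not"
proof (cases "g True"; cases "g False")
  assume "g True" "g False"
  then have "g = (\<lambda>_. True)" by (simp add: fun_eq_iff all_bool_eq)
  then show ?thesis by (rule that)
next
  assume "g True" "\<not> g False"
  then have "g = (\<lambda>x. x)" by (simp add: fun_eq_iff all_bool_eq)
  then show ?thesis by (rule that)
next
  assume "\<not> g True" "g False"
  then have "g = Not" by (simp add: fun_eq_iff all_bool_eq)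
  then show ?thesis by (rule that)
next
  assume "\<not> g True" "\<not> g False"
  then have "g = (\<lambda>_. False)" by (simp add: fun_eq_iff all_bool_eq)
  then show ?thesis by (rule that)
qed

text \<open>Coordinate 0 selects representatives of complementary pairs, hence positive arity. A
  nonempty \<open>R\<close> supplies a tuple to which constant polymorphisms can be applied.\<close>

lemma essentially_unary_upp:
  assumes rel: "\<Delta> \<subseteq> relations" and eu: "\<forall>f\<in>Pol \<Delta>. essentially_unary f"
    and R: "(n, R) \<in> pp_closure \<Delta>" and n: "0 < n" and ne: "R \<noteq> {}"
  shows "(n, R) \<in> upp_closure \<Delta>"
proof -
  define T where "T = {t \<in> R. (unary_pol \<Delta> Not \<longrightarrow> \<not> t ! 0) \<and>
    (\<forall>c. unary_pol \<Delta> (\<lambda>_. c) \<longrightarrow> t \<noteq> replicate n c)}"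
  have len: "length t = n" if "t \<in> R" for t using pp_closure_length[OF R that] .
  have cl: "map g t \<in> R" if "unary_pol \<Delta> g" "t \<in> R" for g t
    using pp_closure_unary_pol[OF rel R that] .
  have neg_const: "unary_pol \<Delta> (\<lambda>_. \<not> c)" if "unary_pol \<Delta> Not" "unary_pol \<Delta> (\<lambda>_. c)" for c
    using unary_pol_comp[OF that] .
  have id: "unary_pol \<Delta> (\<lambda>x. x)" by (auto simp: unary_pol_def)
  have gen: "(\<exists>c. unary_pol \<Delta> (\<lambda>_. c) \<and> x = replicate n c) \<or>
      (\<exists>g. \<exists>t\<in>T. unary_pol \<Delta> g \<and> x = map g t)" if x: "x \<in> R" for x
  proof (cases "\<exists>c. unary_pol \<Delta> (\<lambda>_. c) \<and> x = replicate n c")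
    case nc: False
    show ?thesis
    proof (cases "unary_pol \<Delta> Not \<and> x ! 0")
      case True
      \<comment> \<open>Negating \<open>x\<close> cannot lead to a discarded constant tuple: by
        \<open>neg_const\<close> the tuple \<open>x\<close> would then be one as well.\<close>
      have "map Not x \<noteq> replicate n c" if "unary_pol \<Delta> (\<lambda>_. c)" for c
      proof
        assume "map Not x = replicate n c"
        then have "map Not (map Not x) = replicate n (\<not> c)" by simp
        then have "x = replicate n (\<not> c)" by (simp add: comp_def)
        then show False using nc neg_const True that by blast
      qed
      then have "map Not x \<in> T"
        using True cl x len[OF x] n by (auto simp: T_def)
      moreover have "x = map Not (map Not x)" by (simp add: comp_def)
      ultimately show ?thesis using True by blast
    next
      case False
      then have "x \<in> T" using nc x by (auto simp: T_def)
      then show ?thesis using id by force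
    qed
  qed simp
  have const_mem: "replicate n c \<in> R" if "unary_pol \<Delta> (\<lambda>_. c)" for c
    using ne cl[OF that] len by (auto simp: map_replicate_const)
  show ?thesis
  proof (cases "T = {}")
    case True
    then have "R = {replicate n c | c. unary_pol \<Delta> (\<lambda>_. c)}"
      using gen const_mem by blast
    then show ?thesis using constant_relation_upp[OF rel n _ ne] by blast
  next
    case False
    have "R \<subseteq> {xs. set xs \<subseteq> UNIV \<and> length xs = n}" using len by auto
    then have "finite R" using finite_lists_length_eq[of UNIV n] finite_subset finite by blast
    then have "finite T" by (simp add: T_def)
    then obtain ts where ts: "set ts = T" "distinct ts" using finite_distinct_list by blast
    let ?k = "length ts"
    have k: "1 \<le> ?k" using False ts by (cases ts) auto
    have lenT: "length t = n" if "t \<in> T" for t using len that by (simp add: T_def)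
    have ap: "map (\<lambda>j. f (map (\<lambda>t. t ! j) ts)) [0..<n] = map g (ts ! i)"
      if "i < ?k" "\<And>xs. length xs = ?k \<Longrightarrow> f xs = g (xs ! i)" for f g i
      using that lenT[of "ts ! i"] ts(1) nth_mem[of i ts] by (intro nth_equalityI) auto
    show ?thesis
    proof (rule generated_relation_upp[OF rel k])
      show "R = {map (\<lambda>j. f (map (\<lambda>t. t ! j) ts)) [0..<n] | f. (?k, f) \<in> Pol \<Delta>}" (is "_ = ?C")
      proof (intro set_eqI iffI)
        fix x assume x: "x \<in> R"
        have "\<exists>g. \<exists>i<?k. unary_pol \<Delta> g \<and> x = map g (ts ! i)"
          using gen[OF x]
        proof
          assume "\<exists>c. unary_pol \<Delta> (\<lambda>_. c) \<and> x = replicate n c"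
          then obtain c where c: "unary_pol \<Delta> (\<lambda>_. c)" "x = replicate n c" by blast
          \<comment> \<open>A constant polymorphism gives the same tuple from every row, so row 0
            serves.\<close>
          have "0 < ?k" using k by linarith
          moreover have "x = map (\<lambda>_. c) (ts ! 0)"
            using c(2) lenT[of "ts ! 0"] ts(1) nth_mem[OF \<open>0 < ?k\<close>] by (simp add: map_replicate_const)
          ultimately show ?thesis using c by blast
        next
          assume "\<exists>g. \<exists>t\<in>T. unary_pol \<Delta> g \<and> x = map g t"
          then show ?thesis using ts(1) by (metis in_set_conv_nth)
        qed
        then obtain g i where g: "i < ?k" "unary_pol \<Delta> g" "x = map g (ts ! i)" by blast
        have "x = map (\<lambda>j. (\<lambda>xs. g (xs ! i)) (map (\<lambda>t. t ! j) ts)) [0..<n]"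
          using ap[of i "\<lambda>xs. g (xs ! i)" g] g by simp
        then show "x \<in> ?C"
          using Pol_unary[OF rel g(2,1)] by (intro CollectI exI[of _ "\<lambda>xs. g (xs ! i)"]) simp
      next
        fix x assume "x \<in> ?C"
        then obtain f where f: "(?k, f) \<in> Pol \<Delta>"
          and x: "x = map (\<lambda>j. f (map (\<lambda>t. t ! j) ts)) [0..<n]" by blast
        have "preserves (?k, f) (n, R)" using preserves_pp_closure[OF f R] .
        moreover have "set ts \<subseteq> R" using ts by (auto simp: T_def)
        ultimately show "x \<in> R" by (auto simp: preserves_def x)
      qed
      \<comment> \<open>The two polymorphisms act as \<open>g\<close> on row \<open>i\<close> and as
        \<open>g'\<close> on row \<open>i'\<close>. Equal images must force \<open>g = g'\<close>,
        and also \<open>i = i'\<close> unless \<open>g\<close> is constant.\<close>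
      fix f f' :: "bool list \<Rightarrow> bool" and u :: "bool list"
      assume f: "(?k, f) \<in> Pol \<Delta>" and f': "(?k, f') \<in> Pol \<Delta>"
        and eq: "\<And>j. j < n \<Longrightarrow> f (map (\<lambda>t. t ! j) ts) = f' (map (\<lambda>t. t ! j) ts)"
        and u: "length u = ?k"
      obtain g i where g: "unary_pol \<Delta> g" "i < ?k" "\<And>xs. length xs = ?k \<Longrightarrow> f xs = g (xs ! i)"
        using essentially_unary_Pol[OF rel f] eu f by blast
      obtain g' i' where g': "unary_pol \<Delta> g'" "i' < ?k"
        "\<And>xs. length xs = ?k \<Longrightarrow> f' xs = g' (xs ! i')"
        using essentially_unary_Pol[OF rel f'] eu f' by blast
      have "map (\<lambda>j. f (map (\<lambda>t. t ! j) ts)) [0..<n] = map (\<lambda>j. f' (map (\<lambda>t. t ! j) ts)) [0..<n]"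
        using eq by (intro map_cong) auto
      moreover have "map (\<lambda>j. f (map (\<lambda>t. t ! j) ts)) [0..<n] = map g (ts ! i)"
        by (rule ap) (fact g)+
      moreover have "map (\<lambda>j. f' (map (\<lambda>t. t ! j) ts)) [0..<n] = map g' (ts ! i')"
        by (rule ap) (fact g')+
      ultimately have e: "map g (ts ! i) = map g' (ts ! i')" by (simp only:)
      have tT: "ts ! i \<in> T" "ts ! i' \<in> T" using ts g(2) g'(2) nth_mem by blast+
      have not_const: "t \<noteq> replicate n c" if "unary_pol \<Delta> (\<lambda>_. c)" "t \<in> T" for c t
        using that by (simp add: T_def)
      \<comment> \<open>If \<open>h\<close> were the identity or negation, \<open>t\<close> would be
        a constant tuple whose constant is a polymorphism, and such tuples are not in
        \<open>T\<close>.\<close>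
      have const: "h = (\<lambda>_. c)" if "unary_pol \<Delta> (\<lambda>_. c)" "unary_pol \<Delta> h" "t \<in> T"
        "map h t = map (\<lambda>_. c) s" "s \<in> T" for h c s t
      proof -
        have e: "map h t = replicate n c"
          using that(4) lenT[OF that(5)] by (simp add: map_replicate_const)
        show ?thesis
        proof (cases h rule: bool_fun_cases)
          case (1 d)
          then show ?thesis using e lenT[OF that(3)] n
            by (simp add: map_replicate_const)
        next
          case 2
          then have "t = replicate n c" using e by simp
          then show ?thesis using not_const[OF that(1,3)] by contradiction
        next
          case 3
          then have "map Not (map Not t) = replicate n (\<not> c)" using e by simp
          then have "t = replicate n (\<not> c)" by (simp add: comp_def)
          moreover have "unary_pol \<Delta> (\<lambda>_. \<not> c)" using neg_const that(1,2) 3 by blast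
          ultimately show ?thesis using not_const that(3) by blast
        qed
      qed
      \<comment> \<open>When negation is a polymorphism, all members of \<open>T\<close> have first
        entry \<open>False\<close>, and complementing would flip it.\<close>
      have not_compl: False if "unary_pol \<Delta> Not" "s \<in> T" "t \<in> T" "s = map Not t" for s t
        using that n lenT[OF that(3)] by (auto simp: T_def)
      have ii: "i = i'" if "ts ! i = ts ! i'"
        using that ts(2) g(2) g'(2) nth_eq_iff_index_eq by blast
      \<comment> \<open>For a constant \<open>g\<close> the rows may differ, since the value then
        does not depend on the argument.\<close>
      have "g = g' \<and> (i = i' \<or> (\<exists>c. g = (\<lambda>_. c)))"
      proof (cases g rule: bool_fun_cases)
        case (1 c)
        then show ?thesis using const[of c g' "ts ! i'" "ts ! i"] g(1) g'(1) tT e by auto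
      next
        case 2
        show ?thesis
        proof (cases g' rule: bool_fun_cases)
          case (1 c)
          then show ?thesis using const[of c g "ts ! i" "ts ! i'"] g(1) g'(1) tT e by auto
        next
          case 2
          then show ?thesis using \<open>g = (\<lambda>x. x)\<close> e ii by simp
        next
          case 3
          then have "ts ! i = map Not (ts ! i')" using \<open>g = (\<lambda>x. x)\<close> e by simp
          then show ?thesis using not_compl tT g'(1) 3 by blast
        qed
      next
        case 3
        show ?thesis
        proof (cases g' rule: bool_fun_cases)
          case (1 c)
          then show ?thesis using const[of c g "ts ! i" "ts ! i'"] g(1) g'(1) tT e by auto
        next
          case 2
          then have "ts ! i' = map Not (ts ! i)" using \<open>g = Not\<close> e by simp
          then show ?thesis using not_compl tT g(1) \<open>g = Not\<close> by blast
        next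
          case 3
          have "map Not (map Not (ts ! i)) = map Not (map Not (ts ! i'))"
            using 3 \<open>g = Not\<close> e by simp
          then show ?thesis using 3 \<open>g = Not\<close> ii by (simp add: comp_def)
        qed
      qed
      then show "f u = f' u" using g(3)[OF u] g'(3)[OF u] by auto
    qed
  qed
qed

section \<open>Degenerate relations and transfer to an arbitrary base\<close>

lemma pp_closure_subset_upp_closure:
  assumes rel: "\<Delta> \<subseteq> relations" and eu: "\<forall>f\<in>Pol \<Delta>. essentially_unary f"
  shows "pp_closure \<Delta> \<subseteq> upp_closure \<Delta>"
proof
  fix r assume r: "r \<in> pp_closure \<Delta>"
  obtain n R where rn: "r = (n, R)" by (cases r)
  consider "R = {}" | "R \<noteq> {}" "n = 0" | "R \<noteq> {}" "0 < n" by blast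
  then show "r \<in> upp_closure \<Delta>"
  proof cases
    \<comment> \<open>No assignment satisfies a conjunction that defines the empty relation, so
      uniqueness is vacuous for any pp-definition of it.\<close>
    case 1
    then have "upp_definition \<Delta> m \<phi> r" if "pp_definition \<Delta> m \<phi> r" for m \<phi>
      using that by (auto simp: rn upp_definition_def pp_definition_def)
    then show ?thesis using r by (auto simp: pp_closure_def upp_closure_def)
  next
    \<comment> \<open>The only nonempty relation of arity 0 is defined by the empty
      conjunction.\<close>
    case 2
    then have "R = {[]}" using pp_closure_length[of n R] r rn by fastforce
    then have "upp_definition \<Delta> 0 [] r"
      using 2 by (auto simp: rn upp_definition_def pp_definition_def wf_conj_def sat_def)
    then show ?thesis by (auto simp: upp_closure_def)
  next
    case 3
    then show ?thesis using essentially_unary_upp[OF rel eu] r rn by blast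
  qed
qed

theorem theorem17:
  fixes \<Gamma> :: "brel set"
  assumes "\<Gamma> \<subseteq> relations"
    and "\<forall>f\<in>Pol \<Gamma>. essentially_unary f"
  shows "uniquely_covered (pp_closure \<Gamma>)"
  unfolding uniquely_covered_def is_base_def
proof (intro allI impI)
  fix \<Delta> assume \<Delta>: "\<Delta> \<subseteq> relations \<and> pp_closure \<Delta> = pp_closure \<Gamma>"
  \<comment> \<open>The relations of \<open>\<Gamma>\<close> are pp-definable over
    \<open>\<Delta>\<close>, hence preserved by its polymorphisms. This passes essential unarity on
    to the base.\<close>
  have "Pol \<Delta> \<subseteq> Pol \<Gamma>"
  proof
    fix p assume p: "p \<in> Pol \<Delta>"
    obtain k f where kf: "p = (k, f)" by (cases p)
    have "preserves (k, f) r" if "r \<in> \<Gamma>" for r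
      using preserves_pp_closure[of k f \<Delta> r] p kf \<Delta> subset_pp_closure[OF assms(1)] that by blast
    then show "p \<in> Pol \<Gamma>" using p kf by (auto simp: Pol_def)
  qed
  then have "pp_closure \<Delta> \<subseteq> upp_closure \<Delta>"
    using pp_closure_subset_upp_closure \<Delta> assms(2) by blast
  moreover have "upp_closure \<Delta> \<subseteq> pp_closure \<Delta>"
    by (auto simp: upp_closure_def pp_closure_def upp_definition_def)
  ultimately show "upp_closure \<Delta> = pp_closure \<Gamma>" using \<Delta> by blast
qed

end
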